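(* For every $\Sigma$-sentence $\phi$ of $\mathcal{L}_{BT}$: if $\mathfrak{F}\models\phi$, then $F\vdash\phi$.
   Context: Bit strings are elements of $\{\mathbf{0},\mathbf{1}\}^*$; $\varepsilon$ is the empty string, $|\alpha|$ the length. The language $\mathcal{L}_{BT}$ has constant symbols $e,0,1$, binary function symbol $\circ$ (also written as juxtaposition), and binary relation symbol $\sqsubseteq$. The structure $\mathfrak{F}$ has universe $\{\mathbf{0},\mathbf{1}\}^*$, interprets $e,0,1$ as $\varepsilon,\mathbf{0},\mathbf{1}$, $\circ$ as concatenation, and $\alpha\sqsubseteq\beta$ as $|\alpha|\le|\beta|$. $(\exists x\sqsubseteq t)\phi$ abbreviates $\exists x[x\sqsubseteq t\wedge\phi]$, $(\forall x\sqsubseteq t)\phi$ abbreviates $\forall x[x\sqsubseteq t\to\phi]$. $\Sigma$-formulas: $s\sqsubseteq t$, $\neg s\sqsubseteq t$, $s=t$, $\neg s=t$ (terms $s,t$) are $\Sigma$-formulas; they are closed under $\wedge,\vee$, and under $(\exists x\sqsubseteq t)$, $(\forall x\sqsubseteq t)$ and $\exists x$ where $x$ does not occur in $t$. The theory $F$ has the axioms: (1) $\forall x[x=ex\wedge x=xe]$; (2) $\forall xyz[(xy)z=x(yz)]$; (3) $\forall xy[x\neq y\to(x0\neq y0\wedge x1\neq y1)]$; (4) $\forall xy[x0\neq y1]$; (5) $\forall x[e\sqsubseteq x]$; (6) $\forall x[x\sqsubseteq e\to x=e]$; (7)–(10): for each $a,b\in\{0,1\}$, $\forall xy[xa\sqsubseteq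 yb\leftrightarrow x\sqsubseteq y]$; (11) $\forall x[x=e\vee\exists y[x=y0\vee x=y1]]$. *)

theory Defs
  imports Main
begin

text \<open>Variables are de Bruijn indices: \<open>Var 0\<close> refers to the innermost enclosing quantifier,
  and an index exceeding the number of enclosing quantifiers is a free variable.\<close>

datatype bt_term =
    Var nat
  | Eps
  | Zero
  | One
  | Cat bt_term bt_term  (infixl "\<cdot>" 75)

datatype bt_form =
    Eq bt_term bt_term
  | Leq bt_term bt_term
  | Neg bt_form
  | And bt_form bt_form
  | Or bt_form bt_form
  | Imp bt_form bt_form
  | All bt_form
  | Ex bt_form

abbreviation Iff :: "bt_form \<Rightarrow> bt_form \<Rightarrow> bt_form" where
  "Iff p q \<equiv> And (Imp p q) (Imp q p)"

primrec tsubst :: "(nat \<Rightarrow> bt_term) \<Rightarrow> bt_term \<Rightarrow> bt_term" where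
  "tsubst \<sigma> (Var n) = \<sigma> n"
| "tsubst \<sigma> Eps = Eps"
| "tsubst \<sigma> Zero = Zero"
| "tsubst \<sigma> One = One"
| "tsubst \<sigma> (s \<cdot> t) = tsubst \<sigma> s \<cdot> tsubst \<sigma> t"

text \<open>Renaming every free variable away from index 0, i.e. weakening by a fresh innermost variable.\<close>

definition tlift :: "bt_term \<Rightarrow> bt_term" where
  "tlift = tsubst (\<lambda>n. Var (Suc n))"

primrec subst :: "(nat \<Rightarrow> bt_term) \<Rightarrow> bt_form \<Rightarrow> bt_form" where
  "subst \<sigma> (Eq s t) = Eq (tsubst \<sigma> s) (tsubst \<sigma> t)"
| "subst \<sigma> (Leq s t) = Leq (tsubst \<sigma> s) (tsubst \<sigma> t)"
| "subst \<sigma> (Neg p) = Neg (subst \<sigma> p)"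
| "subst \<sigma> (And p q) = And (subst \<sigma> p) (subst \<sigma> q)"
| "subst \<sigma> (Or p q) = Or (subst \<sigma> p) (subst \<sigma> q)"
| "subst \<sigma> (Imp p q) = Imp (subst \<sigma> p) (subst \<sigma> q)"
| "subst \<sigma> (All p) = All (subst (case_nat (Var 0) (\<lambda>n. tlift (\<sigma> n))) p)"
| "subst \<sigma> (Ex p) = Ex (subst (case_nat (Var 0) (\<lambda>n. tlift (\<sigma> n))) p)"

definition lift :: "bt_form \<Rightarrow> bt_form" where
  "lift = subst (\<lambda>n. Var (Suc n))"

text \<open>The body of a quantifier with \<open>t\<close> for the quantified variable; the quantifier is
  stripped, so the remaining free variables move down by one.\<close>

definition inst :: "bt_form \<Rightarrow> bt_term \<Rightarrow> bt_form" where
  "inst p t = subst (case_nat t Var) p"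

primrec tfree :: "bt_term \<Rightarrow> nat set" where
  "tfree (Var n) = {n}"
| "tfree Eps = {}"
| "tfree Zero = {}"
| "tfree One = {}"
| "tfree (s \<cdot> t) = tfree s \<union> tfree t"

primrec free :: "bt_form \<Rightarrow> nat set" where
  "free (Eq s t) = tfree s \<union> tfree t"
| "free (Leq s t) = tfree s \<union> tfree t"
| "free (Neg p) = free p"
| "free (And p q) = free p \<union> free q"
| "free (Or p q) = free p \<union> free q"
| "free (Imp p q) = free p \<union> free q"
| "free (All p) = {n. Suc n \<in> free p}"
| "free (Ex p) = {n. Suc n \<in> free p}"

definition sentence :: "bt_form \<Rightarrow> bool" where
  "sentence p \<longleftrightarrow> free p = {}"

text \<open>The structure \<open>\<FF>\<close>: bit strings are lists of booleans, with \<open>False\<close> for the bit 0 and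
  \<open>True\<close> for the bit 1.\<close>

primrec val :: "(nat \<Rightarrow> bool list) \<Rightarrow> bt_term \<Rightarrow> bool list" where
  "val e (Var n) = e n"
| "val e Eps = []"
| "val e Zero = [False]"
| "val e One = [True]"
| "val e (s \<cdot> t) = val e s @ val e t"

primrec sat :: "(nat \<Rightarrow> bool list) \<Rightarrow> bt_form \<Rightarrow> bool" where
  "sat e (Eq s t) \<longleftrightarrow> val e s = val e t"
| "sat e (Leq s t) \<longleftrightarrow> length (val e s) \<le> length (val e t)"
| "sat e (Neg p) \<longleftrightarrow> \<not> sat e p"
| "sat e (And p q) \<longleftrightarrow> sat e p \<and> sat e q"
| "sat e (Or p q) \<longleftrightarrow> sat e p \<or> sat e q"
| "sat e (Imp p q) \<longleftrightarrow> (sat e p \<longrightarrow> sat e q)"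
| "sat e (All p) \<longleftrightarrow> (\<forall>\<alpha>. sat (case_nat \<alpha> e) p)"
| "sat e (Ex p) \<longleftrightarrow> (\<exists>\<alpha>. sat (case_nat \<alpha> e) p)"

definition true_in_FF :: "bt_form \<Rightarrow> bool"  ("\<FF> \<Turnstile> _" [51] 50) where
  "\<FF> \<Turnstile> p \<longleftrightarrow> (\<forall>e. sat e p)"

text \<open>In the bounded quantifiers the bound \<open>t\<close> lives outside the scope of the quantifier; lifting
  it expresses that the quantified variable does not occur in it.\<close>

abbreviation BEx :: "bt_term \<Rightarrow> bt_form \<Rightarrow> bt_form" where
  "BEx t p \<equiv> Ex (And (Leq (Var 0) (tlift t)) p)"

abbreviation BAll :: "bt_term \<Rightarrow> bt_form \<Rightarrow> bt_form" where
  "BAll t p \<equiv> All (Imp (Leq (Var 0) (tlift t)) p)"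

inductive Sigma_form :: "bt_form \<Rightarrow> bool" where
  "Sigma_form (Leq s t)"
| "Sigma_form (Neg (Leq s t))"
| "Sigma_form (Eq s t)"
| "Sigma_form (Neg (Eq s t))"
| "Sigma_form p \<Longrightarrow> Sigma_form q \<Longrightarrow> Sigma_form (And p q)"
| "Sigma_form p \<Longrightarrow> Sigma_form q \<Longrightarrow> Sigma_form (Or p q)"
| "Sigma_form p \<Longrightarrow> Sigma_form (BEx t p)"
| "Sigma_form p \<Longrightarrow> Sigma_form (BAll t p)"
| "Sigma_form p \<Longrightarrow> Sigma_form (Ex p)"

text \<open>Derivability in classical first-order logic with equality, as natural deduction. In
  \<open>AllI\<close> and \<open>ExE\<close>, lifting the context (and the conclusion) makes index 0 the eigenvariable.\<close>

inductive derives :: "bt_form set \<Rightarrow> bt_form \<Rightarrow> bool"  (infix "\<turnstile>" 50) where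
  Assm: "p \<in> \<Gamma> \<Longrightarrow> \<Gamma> \<turnstile> p"
| NegI: "insert p \<Gamma> \<turnstile> q \<Longrightarrow> insert p \<Gamma> \<turnstile> Neg q \<Longrightarrow> \<Gamma> \<turnstile> Neg p"
| NegE: "\<Gamma> \<turnstile> p \<Longrightarrow> \<Gamma> \<turnstile> Neg p \<Longrightarrow> \<Gamma> \<turnstile> q"
| Classical: "insert (Neg p) \<Gamma> \<turnstile> p \<Longrightarrow> \<Gamma> \<turnstile> p"
| AndI: "\<Gamma> \<turnstile> p \<Longrightarrow> \<Gamma> \<turnstile> q \<Longrightarrow> \<Gamma> \<turnstile> And p q"
| AndE1: "\<Gamma> \<turnstile> And p q \<Longrightarrow> \<Gamma> \<turnstile> p"
| AndE2: "\<Gamma> \<turnstile> And p q \<Longrightarrow> \<Gamma> \<turnstile> q"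
| OrI1: "\<Gamma> \<turnstile> p \<Longrightarrow> \<Gamma> \<turnstile> Or p q"
| OrI2: "\<Gamma> \<turnstile> q \<Longrightarrow> \<Gamma> \<turnstile> Or p q"
| OrE: "\<Gamma> \<turnstile> Or p q \<Longrightarrow> insert p \<Gamma> \<turnstile> r \<Longrightarrow> insert q \<Gamma> \<turnstile> r \<Longrightarrow> \<Gamma> \<turnstile> r"
| ImpI: "insert p \<Gamma> \<turnstile> q \<Longrightarrow> \<Gamma> \<turnstile> Imp p q"
| ImpE: "\<Gamma> \<turnstile> Imp p q \<Longrightarrow> \<Gamma> \<turnstile> p \<Longrightarrow> \<Gamma> \<turnstile> q"
| AllI: "lift ` \<Gamma> \<turnstile> p \<Longrightarrow> \<Gamma> \<turnstile> All p"
| AllE: "\<Gamma> \<turnstile> All p \<Longrightarrow> \<Gamma> \<turnstile> inst p t"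
| ExI: "\<Gamma> \<turnstile> inst p t \<Longrightarrow> \<Gamma> \<turnstile> Ex p"
| ExE: "\<Gamma> \<turnstile> Ex p \<Longrightarrow> insert p (lift ` \<Gamma>) \<turnstile> lift q \<Longrightarrow> \<Gamma> \<turnstile> q"
| Refl: "\<Gamma> \<turnstile> Eq t t"
| Subst: "\<Gamma> \<turnstile> Eq s t \<Longrightarrow> \<Gamma> \<turnstile> inst p s \<Longrightarrow> \<Gamma> \<turnstile> inst p t"

definition theory_F :: "bt_form set" where
  "theory_F =
    (let x = Var 0 in
      {All (And (Eq x (Eps \<cdot> x)) (Eq x (x \<cdot> Eps))),
       All (Leq Eps x),
       All (Imp (Leq x Eps) (Eq x Eps)),
       All (Or (Eq x Eps)
         (let x' = Var 1; y = Var 0  \<comment> \<open>\<open>x'\<close> is \<open>x\<close> seen from under the inner quantifier\<close>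
          in Ex (Or (Eq x' (y \<cdot> Zero)) (Eq x' (y \<cdot> One)))))})
    \<union> (let x = Var 1; y = Var 0 in
      {All (All (Imp (Neg (Eq x y))
         (And (Neg (Eq (x \<cdot> Zero) (y \<cdot> Zero))) (Neg (Eq (x \<cdot> One) (y \<cdot> One)))))),
       All (All (Neg (Eq (x \<cdot> Zero) (y \<cdot> One))))}
      \<union> {All (All (Iff (Leq (x \<cdot> a) (y \<cdot> b)) (Leq x y))) | a b.
           a \<in> {Zero, One} \<and> b \<in> {Zero, One}})
    \<union> (let x = Var 2; y = Var 1; z = Var 0 in
      {All (All (All (Eq ((x \<cdot> y) \<cdot> z) (x \<cdot> (y \<cdot> z)))))})"

end

theory Submission
  imports Defs
begin

text \<open>A bit string \<open>\<alpha>\<close> is named by a left-associated closed term. \<open>F\<close> evaluates closed terms to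
  such names, decides \<open>=\<close> and \<open>\<sqsubseteq>\<close> between them by stripping last bits, and proves
  that \<open>x \<sqsubseteq> \<alpha>\<close> implies that \<open>x\<close> is one of the finitely many strings of length at most
  \<open>|\<alpha>|\<close>, by induction on \<open>\<alpha>\<close> with axiom (11). The theorem follows by induction on
  \<open>\<Sigma>\<close>-formulas whose free variables are replaced by names.\<close>

section \<open>Substitution\<close>

text \<open>This is the substitution that the quantifier clauses of \<open>subst\<close> push into
  the body.\<close>

abbreviation up :: "(nat \<Rightarrow> bt_term) \<Rightarrow> nat \<Rightarrow> bt_term" where
  "up \<sigma> \<equiv> case_nat (Var 0) (\<lambda>n. tlift (\<sigma> n))"

lemma tlift_simps [simp]:
  "tlift (Var n) = Var (Suc n)" "tlift Eps = Eps" "tlift Zero = Zero" "tlift One = One"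
  "tlift (s \<cdot> t) = tlift s \<cdot> tlift t"
  by (simp_all add: tlift_def)

text \<open>A lifted term does not mention index 0, so the head \<open>u\<close> disappears and the
  shift is undone. This simplifies every use of \<open>inst\<close> on a lifted term.\<close>

lemma tsubst_case_nat_tlift [simp]: "tsubst (case_nat u \<sigma>) (tlift t) = tsubst \<sigma> t"
  by (induction t) simp_all

lemma tsubst_Var [simp]: "tsubst Var t = t"
  by (induction t) simp_all

lemma tsubst_tlift: "tsubst (\<lambda>n. tlift (\<sigma> n)) t = tlift (tsubst \<sigma> t)"
  by (induction t) simp_all

lemma tsubst_tsubst: "tsubst \<tau> (tsubst \<sigma> t) = tsubst (\<lambda>n. tsubst \<tau> (\<sigma> n)) t"
  by (induction t) simp_all

lemma up_comp: "(\<lambda>n. tsubst (up \<tau>) (up \<sigma> n)) = up (\<lambda>n. tsubst \<tau> (\<sigma> n))"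
  by (rule ext) (simp add: tsubst_tlift split: nat.split)

lemma subst_subst: "subst \<tau> (subst \<sigma> p) = subst (\<lambda>n. tsubst \<tau> (\<sigma> n)) p"
  by (induction p arbitrary: \<sigma> \<tau>) (simp_all add: tsubst_tsubst up_comp)

text \<open>The instantiation cancels the lifting inside \<open>up\<close>, so both operations merge
  into one substitution; \<open>ExI\<close> and \<open>Subst\<close> can then be used on closed
  instances.\<close>

lemma inst_subst_up: "inst (subst (up \<sigma>) p) t = subst (case_nat t \<sigma>) p"
proof -
  have "(\<lambda>n. tsubst (case_nat t Var) (up \<sigma> n)) = case_nat t \<sigma>"
    by (rule ext) (simp split: nat.split)
  then show ?thesis
    by (simp add: inst_def subst_subst)
qed

lemma tsubst_idle: "\<forall>n\<in>tfree t. \<sigma> n = Var n \<Longrightarrow> tsubst \<sigma> t = t"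
  by (induction t) simp_all

lemma subst_idle: "\<forall>n\<in>free p. \<sigma> n = Var n \<Longrightarrow> subst \<sigma> p = p"
proof (induction p arbitrary: \<sigma>)
  case (All p)
  have "subst (up \<sigma>) p = p"
    by (rule All.IH) (use All.prems in \<open>auto split: nat.split\<close>)
  then show ?case by simp
next
  case (Ex p)
  have "subst (up \<sigma>) p = p"
    by (rule Ex.IH) (use Ex.prems in \<open>auto split: nat.split\<close>)
  then show ?case by simp
qed (simp_all add: tsubst_idle ball_Un)

text \<open>This serves twice: lifting fixes the axioms, and replacing variables by names fixes the
  final sentence.\<close>

lemma subst_sentence: "sentence p \<Longrightarrow> subst \<sigma> p = p"
  by (simp add: sentence_def subst_idle)

section \<open>Derived rules\<close>

text \<open>Weakening is admissible although it is not a rule. The larger context is arbitrary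
  because some rules extend the context or lift it, and the induction hypothesis is then used for
  the extended or lifted one.\<close>

lemma derives_mono: "\<Gamma> \<turnstile> p \<Longrightarrow> \<Gamma> \<subseteq> \<Delta> \<Longrightarrow> \<Delta> \<turnstile> p"
proof (induction arbitrary: \<Delta> rule: derives.induct)
  case (NegI p \<Gamma> q) then show ?case by (meson derives.NegI insert_mono)
next
  case (Classical p \<Gamma>) then show ?case by (meson derives.Classical insert_mono)
next
  case (OrE \<Gamma> p q r) then show ?case by (meson derives.OrE insert_mono)
next
  case (ImpI p \<Gamma> q) then show ?case by (meson derives.ImpI insert_mono)
next
  case (AllI \<Gamma> p) then show ?case by (meson derives.AllI image_mono)
next
  case (ExE \<Gamma> p q) then show ?case by (meson derives.ExE insert_mono image_mono)
qed (blast intro: derives.intros)+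

lemma derives_contrapos: "\<Gamma> \<turnstile> Neg q \<Longrightarrow> insert p \<Gamma> \<turnstile> q \<Longrightarrow> \<Gamma> \<turnstile> Neg p"
  by (meson NegI derives_mono subset_insertI)

text \<open>In each use of \<open>Subst\<close>, \<open>Var 0\<close> marks the hole to be
  rewritten; terms that must stay fixed are lifted, so that instantiation returns them
  unchanged.\<close>

lemma Eq_sym:
  assumes "\<Gamma> \<turnstile> Eq s t" shows "\<Gamma> \<turnstile> Eq t s"
  using Subst[OF assms, of "Eq (Var 0) (tlift s)"] by (simp add: inst_def Refl)

lemma Eq_trans [trans]:
  assumes "\<Gamma> \<turnstile> Eq s t" "\<Gamma> \<turnstile> Eq t u" shows "\<Gamma> \<turnstile> Eq s u"
  using Subst[OF assms(2), of "Eq (tlift s) (Var 0)"] assms(1) by (simp add: inst_def)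

lemma Eq_Cat:
  assumes "\<Gamma> \<turnstile> Eq s s'" "\<Gamma> \<turnstile> Eq t t'" shows "\<Gamma> \<turnstile> Eq (s \<cdot> t) (s' \<cdot> t')"
proof (rule Eq_trans)
  show "\<Gamma> \<turnstile> Eq (s \<cdot> t) (s' \<cdot> t)"
    using Subst[OF assms(1), of "Eq (tlift (s \<cdot> t)) (Var 0 \<cdot> tlift t)"]
    by (simp add: inst_def Refl)
  show "\<Gamma> \<turnstile> Eq (s' \<cdot> t) (s' \<cdot> t')"
    using Subst[OF assms(2), of "Eq (tlift (s' \<cdot> t)) (tlift s' \<cdot> Var 0)"]
    by (simp add: inst_def Refl)
qed

lemma Leq_cong:
  assumes "\<Gamma> \<turnstile> Eq s s'" "\<Gamma> \<turnstile> Eq t t'" "\<Gamma> \<turnstile> Leq s t" shows "\<Gamma> \<turnstile> Leq s' t'"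
proof -
  have "\<Gamma> \<turnstile> Leq s' t"
    using Subst[OF assms(1), of "Leq (Var 0) (tlift t)"] assms(3) by (simp add: inst_def)
  then show ?thesis
    using Subst[OF assms(2), of "Leq (tlift s') (Var 0)"] by (simp add: inst_def)
qed

text \<open>The language has no falsum, so a refutable equation stands for the empty
  disjunction.\<close>

primrec disj :: "bt_form list \<Rightarrow> bt_form" where
  "disj [] = Neg (Eq Eps Eps)"
| "disj (p # ps) = Or p (disj ps)"

lemma subst_disj [simp]: "subst \<sigma> (disj ps) = disj (map (subst \<sigma>) ps)"
  by (induction ps) simp_all

lemma disjI: "p \<in> set ps \<Longrightarrow> \<Gamma> \<turnstile> p \<Longrightarrow> \<Gamma> \<turnstile> disj ps"
  by (induction ps) (auto intro: OrI1 OrI2)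

lemma disjE: "\<Gamma> \<turnstile> disj ps \<Longrightarrow> (\<And>p. p \<in> set ps \<Longrightarrow> insert p \<Gamma> \<turnstile> q) \<Longrightarrow> \<Gamma> \<turnstile> q"
proof (induction ps arbitrary: \<Gamma>)
  case Nil
  then show ?case by (auto intro: NegE Refl)
next
  case (Cons p ps)
  show ?case
  proof (rule OrE)
    show "\<Gamma> \<turnstile> Or p (disj ps)" using Cons.prems(1) by simp
    show "insert p \<Gamma> \<turnstile> q" using Cons.prems(2) by simp
    show "insert (disj ps) \<Gamma> \<turnstile> q"
    proof (rule Cons.IH)
      show "insert (disj ps) \<Gamma> \<turnstile> disj ps" by (simp add: Assm)
      show "insert r (insert (disj ps) \<Gamma>) \<turnstile> q" if "r \<in> set ps" for r
        using Cons.prems(2)[of r] that by (auto intro: derives_mono)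
    qed
  qed
qed

section \<open>The axioms of \<open>F\<close>\<close>

definition bit_term :: "bool \<Rightarrow> bt_term" where
  "bit_term b = (if b then One else Zero)"

lemma tsubst_bit [simp]: "tsubst \<sigma> (bit_term b) = bit_term b"
  by (simp add: bit_term_def)

text \<open>The axioms are closed, so they remain available below the eigenvariable of
  \<open>AllI\<close> and \<open>ExE\<close>.\<close>

lemma lift_theory_F: "lift ` theory_F = theory_F"
proof -
  have "sentence p" if "p \<in> theory_F" for p
    using that by (auto simp: theory_F_def Let_def sentence_def)
  then show ?thesis by (simp add: lift_def subst_sentence)
qed

section \<open>Term instances of the axioms, in any context that contains them\<close>

context
  fixes \<Gamma> :: "bt_form set"
  assumes F: "theory_F \<subseteq> \<Gamma>"
begin

lemma F_Assm: "p \<in> theory_F \<Longrightarrow> \<Gamma> \<turnstile> p"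
  using F by (blast intro: Assm)

lemma F_Eps_Cat: "\<Gamma> \<turnstile> Eq t (Eps \<cdot> t)"
  and F_Cat_Eps: "\<Gamma> \<turnstile> Eq t (t \<cdot> Eps)"
proof -
  have "\<Gamma> \<turnstile> All (And (Eq (Var 0) (Eps \<cdot> Var 0)) (Eq (Var 0) (Var 0 \<cdot> Eps)))"
    by (rule F_Assm) (simp add: theory_F_def Let_def)
  from AllE[OF this, of t] show "\<Gamma> \<turnstile> Eq t (Eps \<cdot> t)" "\<Gamma> \<turnstile> Eq t (t \<cdot> Eps)"
    by (auto simp: inst_def intro: AndE1 AndE2)
qed

lemma F_assoc: "\<Gamma> \<turnstile> Eq ((s \<cdot> t) \<cdot> u) (s \<cdot> (t \<cdot> u))"
proof -
  have "\<Gamma> \<turnstile> All (All (All (Eq ((Var 2 \<cdot> Var 1) \<cdot> Var 0) (Var 2 \<cdot> (Var 1 \<cdot> Var 0)))))"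
    by (rule F_Assm) (simp add: theory_F_def Let_def)
  from AllE[OF this, of s]
  \<comment> \<open>The term \<open>s\<close> is lifted once for each quantifier still in
    front.\<close>
  have "\<Gamma> \<turnstile> All (All (Eq ((tlift (tlift s) \<cdot> Var 1) \<cdot> Var 0) (tlift (tlift s) \<cdot> (Var 1 \<cdot> Var 0))))"
    by (simp add: inst_def numeral_2_eq_2)
  from AllE[OF this, of t]
  have "\<Gamma> \<turnstile> All (Eq ((tlift s \<cdot> tlift t) \<cdot> Var 0) (tlift s \<cdot> (tlift t \<cdot> Var 0)))"
    by (simp add: inst_def tsubst_tlift)
  from AllE[OF this, of u] show ?thesis by (simp add: inst_def)
qed

lemma F_Cat_bit_inj:
  assumes "\<Gamma> \<turnstile> Neg (Eq s t)" shows "\<Gamma> \<turnstile> Neg (Eq (s \<cdot> bit_term b) (t \<cdot> bit_term b))"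
proof -
  have "\<Gamma> \<turnstile> All (All (Imp (Neg (Eq (Var 1) (Var 0)))
      (And (Neg (Eq (Var 1 \<cdot> Zero) (Var 0 \<cdot> Zero))) (Neg (Eq (Var 1 \<cdot> One) (Var 0 \<cdot> One))))))"
    by (rule F_Assm) (simp add: theory_F_def Let_def)
  from AllE[OF this, of s]
  have "\<Gamma> \<turnstile> All (Imp (Neg (Eq (tlift s) (Var 0)))
      (And (Neg (Eq (tlift s \<cdot> Zero) (Var 0 \<cdot> Zero))) (Neg (Eq (tlift s \<cdot> One) (Var 0 \<cdot> One)))))"
    by (simp add: inst_def)
  from AllE[OF this, of t]
  have "\<Gamma> \<turnstile> Imp (Neg (Eq s t))
      (And (Neg (Eq (s \<cdot> Zero) (t \<cdot> Zero))) (Neg (Eq (s \<cdot> One) (t \<cdot> One))))"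
    by (simp add: inst_def)
  from ImpE[OF this assms] show ?thesis
    by (auto simp: bit_term_def intro: AndE1 AndE2)
qed

lemma F_Cat_bit_distinct:
  assumes "a \<noteq> b" shows "\<Gamma> \<turnstile> Neg (Eq (s \<cdot> bit_term a) (t \<cdot> bit_term b))"
proof -
  have *: "\<Gamma> \<turnstile> Neg (Eq (s \<cdot> Zero) (t \<cdot> One))" for s t
  proof -
    have "\<Gamma> \<turnstile> All (All (Neg (Eq (Var 1 \<cdot> Zero) (Var 0 \<cdot> One))))"
      by (rule F_Assm) (simp add: theory_F_def Let_def)
    from AllE[OF this, of s] have "\<Gamma> \<turnstile> All (Neg (Eq (tlift s \<cdot> Zero) (Var 0 \<cdot> One)))"
      by (simp add: inst_def)
    from AllE[OF this, of t] show ?thesis by (simp add: inst_def)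
  qed
  \<comment> \<open>Axiom (4) has the bits in one order only; the other order follows by symmetry of
    equality.\<close>
  have "\<Gamma> \<turnstile> Neg (Eq (s \<cdot> One) (t \<cdot> Zero))"
    by (rule derives_contrapos[OF *[of t s]]) (rule Eq_sym[OF Assm], simp)
  with * assms show ?thesis by (cases a) (auto simp: bit_term_def)
qed

lemma F_Eps_Leq: "\<Gamma> \<turnstile> Leq Eps t"
proof -
  have "\<Gamma> \<turnstile> All (Leq Eps (Var 0))"
    by (rule F_Assm) (simp add: theory_F_def Let_def)
  from AllE[OF this, of t] show ?thesis by (simp add: inst_def)
qed

lemma F_Leq_Eps:
  assumes "\<Gamma> \<turnstile> Leq t Eps" shows "\<Gamma> \<turnstile> Eq t Eps"
proof -
  have "\<Gamma> \<turnstile> All (Imp (Leq (Var 0) Eps) (Eq (Var 0) Eps))"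
    by (rule F_Assm) (simp add: theory_F_def Let_def)
  from AllE[OF this, of t] have "\<Gamma> \<turnstile> Imp (Leq t Eps) (Eq t Eps)" by (simp add: inst_def)
  then show ?thesis using assms by (rule ImpE)
qed

lemma F_Leq_Cat_bit: "\<Gamma> \<turnstile> Iff (Leq (s \<cdot> bit_term a) (t \<cdot> bit_term b)) (Leq s t)"
proof -
  have "\<Gamma> \<turnstile> All (All (Iff (Leq (Var 1 \<cdot> bit_term a) (Var 0 \<cdot> bit_term b)) (Leq (Var 1) (Var 0))))"
    by (rule F_Assm) (auto simp: theory_F_def Let_def bit_term_def)
  from AllE[OF this, of s]
  have "\<Gamma> \<turnstile> All (Iff (Leq (tlift s \<cdot> bit_term a) (Var 0 \<cdot> bit_term b)) (Leq (tlift s) (Var 0)))"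
    by (simp add: inst_def)
  from AllE[OF this, of t] show ?thesis by (simp add: inst_def)
qed

lemma F_Leq_Cat_bitI: "\<Gamma> \<turnstile> Leq s t \<Longrightarrow> \<Gamma> \<turnstile> Leq (s \<cdot> bit_term a) (t \<cdot> bit_term b)"
  using F_Leq_Cat_bit by (blast intro: AndE2 ImpE)

lemma F_Leq_Cat_bitD: "\<Gamma> \<turnstile> Leq (s \<cdot> bit_term a) (t \<cdot> bit_term b) \<Longrightarrow> \<Gamma> \<turnstile> Leq s t"
  using F_Leq_Cat_bit by (blast intro: AndE1 ImpE)

lemma F_cases:
  "\<Gamma> \<turnstile> Or (Eq t Eps)
    (Ex (Or (Eq (tlift t) (Var 0 \<cdot> bit_term False)) (Eq (tlift t) (Var 0 \<cdot> bit_term True))))"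
proof -
  have "\<Gamma> \<turnstile> All (Or (Eq (Var 0) Eps)
      (Ex (Or (Eq (Var 1) (Var 0 \<cdot> Zero)) (Eq (Var 1) (Var 0 \<cdot> One)))))"
    by (rule F_Assm) (simp add: theory_F_def Let_def)
  from AllE[OF this, of t] show ?thesis by (simp add: inst_def bit_term_def)
qed

end

text \<open>If \<open>ta = e\<close> and \<open>c\<close> is the bit other than \<open>a\<close>, then \<open>ec = c(ta) = (ct)a\<close>, against
  axiom (4).\<close>

lemma F_Cat_bit_neq_Eps:
  assumes "theory_F \<subseteq> \<Gamma>" shows "\<Gamma> \<turnstile> Neg (Eq (t \<cdot> bit_term a) Eps)"
proof (rule derives_contrapos)
  let ?c = "bit_term (\<not> a)" and ?\<Delta> = "insert (Eq (t \<cdot> bit_term a) Eps) \<Gamma>"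
  show "\<Gamma> \<turnstile> Neg (Eq (Eps \<cdot> ?c) ((?c \<cdot> t) \<cdot> bit_term a))"
    using assms by (rule F_Cat_bit_distinct) simp
  have F: "theory_F \<subseteq> ?\<Delta>" using assms by blast
  have "?\<Delta> \<turnstile> Eq (Eps \<cdot> ?c) ?c" by (rule Eq_sym[OF F_Eps_Cat[OF F]])
  also have "?\<Delta> \<turnstile> Eq ?c (?c \<cdot> Eps)" by (rule F_Cat_Eps[OF F])
  also have "?\<Delta> \<turnstile> Eq (?c \<cdot> Eps) (?c \<cdot> (t \<cdot> bit_term a))"
    by (rule Eq_Cat[OF Refl Eq_sym[OF Assm]]) simp
  also have "?\<Delta> \<turnstile> Eq (?c \<cdot> (t \<cdot> bit_term a)) ((?c \<cdot> t) \<cdot> bit_term a)"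
    by (rule Eq_sym[OF F_assoc[OF F]])
  finally show "?\<Delta> \<turnstile> Eq (Eps \<cdot> ?c) ((?c \<cdot> t) \<cdot> bit_term a)" .
qed

section \<open>Names of bit strings\<close>

text \<open>Left association makes the last bit the outermost factor, the shape on which axioms (3),
  (4) and (7)-(11) act.\<close>

definition name :: "bool list \<Rightarrow> bt_term" where
  "name \<alpha> = foldl (\<lambda>t b. t \<cdot> bit_term b) Eps \<alpha>"

lemma name_Nil [simp]: "name [] = Eps"
  and name_snoc [simp]: "name (\<alpha> @ [b]) = name \<alpha> \<cdot> bit_term b"
  by (simp_all add: name_def)

lemma tsubst_name [simp]: "tsubst \<sigma> (name \<alpha>) = name \<alpha>"
  by (induction \<alpha> rule: rev_induct) simp_all

lemma tlift_name [simp]: "tlift (name \<alpha>) = name \<alpha>"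
  by (simp add: tlift_def)

lemma F_name_append:
  assumes F: "theory_F \<subseteq> \<Gamma>" shows "\<Gamma> \<turnstile> Eq (name \<alpha> \<cdot> name \<beta>) (name (\<alpha> @ \<beta>))"
proof (induction \<beta> rule: rev_induct)
  case Nil
  show ?case using Eq_sym[OF F_Cat_Eps[OF F]] by simp
next
  case (snoc b \<beta>)
  have "\<Gamma> \<turnstile> Eq (name \<alpha> \<cdot> (name \<beta> \<cdot> bit_term b)) ((name \<alpha> \<cdot> name \<beta>) \<cdot> bit_term b)"
    by (rule Eq_sym[OF F_assoc[OF F]])
  also have "\<Gamma> \<turnstile> Eq ((name \<alpha> \<cdot> name \<beta>) \<cdot> bit_term b) (name (\<alpha> @ \<beta>) \<cdot> bit_term b)"
    by (rule Eq_Cat[OF snoc Refl])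
  finally show ?case using name_snoc[of "\<alpha> @ \<beta>" b] by simp
qed

lemma F_val:
  assumes F: "theory_F \<subseteq> \<Gamma>"
  shows "\<Gamma> \<turnstile> Eq (tsubst (\<lambda>n. name (e n)) t) (name (val e t))"
proof (induction t)
  case (Cat s t)
  then show ?case by (auto intro: Eq_trans[OF Eq_Cat F_name_append[OF F]])
\<comment> \<open>The name of a single bit is \<open>Eps\<close> followed by that bit, so the
  constants \<open>Zero\<close> and \<open>One\<close> need axiom (1).\<close>
qed (use F_Eps_Cat[OF F] in \<open>simp_all add: Refl name_def bit_term_def\<close>)

text \<open>Last bits are compared: if they differ, axiom (4) applies; if they agree, axiom (3)
  reduces to the shorter names. A nonempty name against \<open>Eps\<close> is settled by
  \<open>F_Cat_bit_neq_Eps\<close>.\<close>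

lemma F_name_neq:
  "\<alpha> \<noteq> \<beta> \<Longrightarrow> theory_F \<turnstile> Neg (Eq (name \<alpha>) (name \<beta>))"
proof (induction \<alpha> arbitrary: \<beta> rule: rev_induct)
  case Nil
  then obtain \<beta>' b where \<beta>: "\<beta> = \<beta>' @ [b]" by (metis rev_exhaust)
  show ?case unfolding \<beta>
    by (rule derives_contrapos[OF F_Cat_bit_neq_Eps[OF order_refl, of "name \<beta>'" b]])
      (rule Eq_sym[OF Assm], simp)
next
  case (snoc a \<alpha>)
  show ?case
  proof (cases \<beta> rule: rev_exhaust)
    case Nil
    then show ?thesis by (simp add: F_Cat_bit_neq_Eps)
  next
    case (snoc \<beta>' b)
    with snoc.prems snoc.IH[of \<beta>'] show ?thesis
      by (cases "a = b") (simp_all add: F_Cat_bit_inj F_Cat_bit_distinct)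
  qed
qed

text \<open>Axioms (7)-(10) add last bits on both sides, whatever the bits are, starting from axiom
  (5).\<close>

lemma F_name_Leq:
  assumes F: "theory_F \<subseteq> \<Gamma>"
  shows "length \<alpha> \<le> length \<beta> \<Longrightarrow> \<Gamma> \<turnstile> Leq (name \<alpha>) (name \<beta>)"
proof (induction \<alpha> arbitrary: \<beta> rule: rev_induct)
  case Nil
  show ?case by (simp add: F_Eps_Leq[OF F])
next
  case (snoc a \<alpha>)
  then show ?case
    by (cases \<beta> rule: rev_exhaust) (simp_all add: F_Leq_Cat_bitI[OF F])
qed

text \<open>Stripping last bits exhausts \<beta> first; then axiom (6) would make a nonempty name
  equal to \<open>Eps\<close>.\<close>

lemma F_name_not_Leq:
  "length \<beta> < length \<alpha> \<Longrightarrow> theory_F \<turnstile> Neg (Leq (name \<alpha>) (name \<beta>))"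
proof (induction \<beta> arbitrary: \<alpha> rule: rev_induct)
  case Nil
  then obtain \<alpha>' a where "\<alpha> = \<alpha>' @ [a]" by (cases \<alpha> rule: rev_exhaust) auto
  moreover have "theory_F \<turnstile> Neg (Leq (name \<alpha>' \<cdot> bit_term a) Eps)"
    by (rule derives_contrapos[OF F_Cat_bit_neq_Eps[OF order_refl] F_Leq_Eps])
      (auto intro: Assm)
  ultimately show ?case by simp
next
  case (snoc b \<beta>)
  then obtain \<alpha>' a where \<alpha>: "\<alpha> = \<alpha>' @ [a]" by (cases \<alpha> rule: rev_exhaust) auto
  have "theory_F \<turnstile> Neg (Leq (name \<alpha>') (name \<beta>))" using snoc \<alpha> by simp
  moreover have "insert (Leq (name \<alpha>) (name (\<beta> @ [b]))) theory_F \<turnstile> Leq (name \<alpha>') (name \<beta>)"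
    by (rule F_Leq_Cat_bitD[of _ _ a _ b]) (auto simp: \<alpha> intro: Assm)
  ultimately show ?case by (rule derives_contrapos)
qed

section \<open>Bounded quantification\<close>

text \<open>These are the strings of length at most \<open>n\<close>, built by appending at the end
  to match axiom (11) and the shape of names.\<close>

primrec strings :: "nat \<Rightarrow> bool list list" where
  "strings 0 = [[]]"
| "strings (Suc n) = [] # map (\<lambda>\<beta>. \<beta> @ [False]) (strings n) @ map (\<lambda>\<beta>. \<beta> @ [True]) (strings n)"

lemma length_strings: "\<beta> \<in> set (strings n) \<Longrightarrow> length \<beta> \<le> n"
  by (induction n arbitrary: \<beta>) auto

definition one_of :: "bt_term \<Rightarrow> nat \<Rightarrow> bt_form" where
  "one_of t n = disj (map (\<lambda>\<beta>. Eq t (name \<beta>)) (strings n))"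

lemma subst_one_of [simp]: "subst \<sigma> (one_of t n) = one_of (tsubst \<sigma> t) n"
  by (simp add: one_of_def o_def)

lemma one_ofI: "\<beta> \<in> set (strings n) \<Longrightarrow> \<Gamma> \<turnstile> Eq t (name \<beta>) \<Longrightarrow> \<Gamma> \<turnstile> one_of t n"
  unfolding one_of_def by (erule disjI[rotated]) simp

lemma one_ofE:
  assumes "\<Gamma> \<turnstile> one_of t n"
    and "\<And>\<beta>. \<beta> \<in> set (strings n) \<Longrightarrow> insert (Eq t (name \<beta>)) \<Gamma> \<turnstile> q"
  shows "\<Gamma> \<turnstile> q"
  using assms(1) unfolding one_of_def by (rule disjE) (auto intro: assms(2))

text \<open>By axiom (11), x is e or yb. In the second case axioms (7)-(10) turn the bound on x into
  y \<sqsubseteq> \<alpha>, and the induction hypothesis lists the possible y. The quantifier is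
  kept inside the formula so that the hypothesis can be instantiated at the eigenvariable y.\<close>

lemma F_Leq_name_All:
  "theory_F \<turnstile> All (Imp (Leq (Var 0) (name \<alpha>)) (one_of (Var 0) (length \<alpha>)))"
proof (induction \<alpha> rule: rev_induct)
  case Nil
  show ?case
    by (rule AllI, rule ImpI, rule one_ofI[of "[]"])
      (auto simp: lift_theory_F intro: F_Leq_Eps Assm)
next
  case (snoc a \<alpha>)
  let ?n = "length \<alpha>" and ?\<Gamma> = "insert (Leq (Var 0) (name (\<alpha> @ [a]))) theory_F"
  let ?eq = "\<lambda>b. Eq (Var 1) (Var 0 \<cdot> bit_term b)"
  \<comment> \<open>This is the case x = yb after the existential of axiom (11) is opened: x has
    become \<open>Var 1\<close>, and \<open>Var 0\<close> is y.\<close>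
  have step: "\<Delta> \<turnstile> one_of (Var 1) (Suc ?n)"
    if F: "theory_F \<subseteq> \<Delta>" and le: "Leq (Var 1) (name \<alpha> \<cdot> bit_term a) \<in> \<Delta>" and eq: "?eq b \<in> \<Delta>"
    for \<Delta> b
  proof -
    have "\<Delta> \<turnstile> Leq (Var 0 \<cdot> bit_term b) (name \<alpha> \<cdot> bit_term a)"
      by (rule Leq_cong[OF Assm[OF eq] Refl Assm[OF le]])
    then have "\<Delta> \<turnstile> Leq (Var 0) (name \<alpha>)" by (rule F_Leq_Cat_bitD[OF F])
    moreover have "\<Delta> \<turnstile> Imp (Leq (Var 0) (name \<alpha>)) (one_of (Var 0) ?n)"
      using AllE[OF derives_mono[OF snoc.IH F], of "Var 0"] by (simp add: inst_def)
    ultimately have "\<Delta> \<turnstile> one_of (Var 0) ?n" by (rule ImpE[rotated])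
    then show ?thesis
    proof (rule one_ofE)
      fix \<beta> assume \<beta>: "\<beta> \<in> set (strings ?n)"
      let ?\<Delta>' = "insert (Eq (Var 0) (name \<beta>)) \<Delta>"
      have "?\<Delta>' \<turnstile> Eq (Var 1) (Var 0 \<cdot> bit_term b)" by (rule Assm) (use eq in simp)
      also have "?\<Delta>' \<turnstile> Eq (Var 0 \<cdot> bit_term b) (name \<beta> \<cdot> bit_term b)"
        by (intro Eq_Cat Refl Assm) simp
      finally have "?\<Delta>' \<turnstile> Eq (Var 1) (name (\<beta> @ [b]))" by simp
      then show "?\<Delta>' \<turnstile> one_of (Var 1) (Suc ?n)"
        \<comment> \<open>The bit decides in which half of \<open>strings (Suc ?n)\<close> the
          extended string lies.\<close>
        by (rule one_ofI[rotated]) (use \<beta> in \<open>cases b; simp\<close>)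
    qed
  qed
  have "?\<Gamma> \<turnstile> one_of (Var 0) (Suc ?n)"
  proof (rule OrE[OF F_cases[of ?\<Gamma> "Var 0"]])
    show "insert (Eq (Var 0) Eps) ?\<Gamma> \<turnstile> one_of (Var 0) (Suc ?n)"
      by (rule one_ofI[of "[]"]) (simp_all add: Assm)
    let ?ex = "Ex (Or (Eq (tlift (Var 0)) (Var 0 \<cdot> bit_term False)) (Eq (tlift (Var 0)) (Var 0 \<cdot> bit_term True)))"
    show "insert ?ex ?\<Gamma> \<turnstile> one_of (Var 0) (Suc ?n)"
    proof (rule ExE)
      show "insert ?ex ?\<Gamma> \<turnstile> Ex (Or (?eq False) (?eq True))" by (simp add: Assm)
      let ?\<Delta> = "insert (Or (?eq False) (?eq True)) (lift ` insert ?ex ?\<Gamma>)"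
      \<comment> \<open>Lifting keeps the axioms, while the assumption about x moves from
        \<open>Var 0\<close> to \<open>Var 1\<close>.\<close>
      have F: "theory_F \<subseteq> ?\<Delta>" using lift_theory_F by auto
      have le: "Leq (Var 1) (name \<alpha> \<cdot> bit_term a) \<in> ?\<Delta>" by (simp add: lift_def)
      have "?\<Delta> \<turnstile> one_of (Var 1) (Suc ?n)"
      proof (rule OrE)
        show "?\<Delta> \<turnstile> Or (?eq False) (?eq True)" by (simp add: Assm)
        show "insert (?eq False) ?\<Delta> \<turnstile> one_of (Var 1) (Suc ?n)"
          by (rule step[of _ False]) (use F le in blast)+
        show "insert (?eq True) ?\<Delta> \<turnstile> one_of (Var 1) (Suc ?n)"
          by (rule step[of _ True]) (use F le in blast)+
      qed
      then show "?\<Delta> \<turnstile> lift (one_of (Var 0) (Suc ?n))" by (simp add: lift_def)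
    qed
  qed blast
  then show ?case
    by (simp add: lift_theory_F AllI ImpI)
qed

lemma F_Leq_nameD:
  assumes F: "theory_F \<subseteq> \<Gamma>" and "\<Gamma> \<turnstile> Leq t (name \<alpha>)"
  shows "\<Gamma> \<turnstile> one_of t (length \<alpha>)"
proof -
  have "\<Gamma> \<turnstile> Imp (Leq t (name \<alpha>)) (one_of t (length \<alpha>))"
    using AllE[OF derives_mono[OF F_Leq_name_All[of \<alpha>] F], of t] by (simp add: inst_def)
  then show ?thesis using assms(2) by (rule ImpE)
qed

section \<open>\<open>\<Sigma>\<close>-completeness\<close>

abbreviation close :: "(nat \<Rightarrow> bool list) \<Rightarrow> nat \<Rightarrow> bt_term" where
  "close e \<equiv> \<lambda>n. name (e n)"

text \<open>Instantiating a quantifier by a name corresponds to extending the assignment, as in the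
  quantifier clauses of \<open>sat\<close>.\<close>

lemma inst_close: "inst (subst (up (close e)) p) (name \<alpha>) = subst (close (case_nat \<alpha> e)) p"
proof -
  have "case_nat (name \<alpha>) (close e) = close (case_nat \<alpha> e)"
    by (rule ext) (simp split: nat.split)
  then show ?thesis using inst_subst_up[of "close e" p "name \<alpha>"] by simp
qed

lemma val_tlift [simp]: "val (case_nat \<alpha> e) (tlift t) = val e t"
  by (induction t) simp_all

lemma tlift_close: "tlift (tsubst (close e) t) = tsubst (close e) t"
  by (simp add: tlift_def tsubst_tsubst)

lemma Ex_close:
  "theory_F \<turnstile> subst (close (case_nat \<alpha> e)) p \<Longrightarrow> theory_F \<turnstile> subst (close e) (Ex p)"
  using ExI[of theory_F "subst (up (close e)) p" "name \<alpha>"] by (simp only: inst_close subst.simps)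

text \<open>Inside F the bound evaluates to a name, so x equals one of finitely many names. The
  premise proves the body for each of them, and equality carries it back to x.\<close>

lemma BAll_close:
  assumes "\<And>\<beta>. length \<beta> \<le> length (val e t) \<Longrightarrow> theory_F \<turnstile> subst (close (case_nat \<beta> e)) p"
  shows "theory_F \<turnstile> subst (close e) (BAll t p)"
proof -
  let ?q = "subst (up (close e)) p" and ?\<Gamma> = "insert (Leq (Var 0) (tsubst (close e) t)) theory_F"
  have F: "theory_F \<subseteq> ?\<Gamma>" by blast
  have "?\<Gamma> \<turnstile> Leq (Var 0) (name (val e t))"
    by (rule Leq_cong[OF Refl F_val[OF F]]) (simp add: Assm)
  from F_Leq_nameD[OF F this] have "?\<Gamma> \<turnstile> ?q"
  proof (rule one_ofE)
    fix \<beta> assume "\<beta> \<in> set (strings (length (val e t)))"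
    then have "theory_F \<turnstile> inst ?q (name \<beta>)"
      unfolding inst_close by (intro assms length_strings)
    then have "insert (Eq (Var 0) (name \<beta>)) ?\<Gamma> \<turnstile> inst ?q (name \<beta>)"
      by (rule derives_mono) blast
    with Eq_sym[OF Assm] have "insert (Eq (Var 0) (name \<beta>)) ?\<Gamma> \<turnstile> inst ?q (Var 0)"
      by (rule Subst) simp
    \<comment> \<open>Instantiating by \<open>Var 0\<close> changes nothing: all other variables
      have been replaced by closed names.\<close>
    then show "insert (Eq (Var 0) (name \<beta>)) ?\<Gamma> \<turnstile> ?q"
      using inst_subst_up[of "close e" p "Var 0"] by simp
  qed
  then have "theory_F \<turnstile> All (Imp (Leq (Var 0) (tsubst (close e) t)) ?q)"
    by (simp add: lift_theory_F AllI ImpI)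
  then show ?thesis by (simp add: tlift_close tsubst_tlift)
qed

text \<open>Assignments cover open formulas, and \<open>e\<close> is arbitrary because quantifiers
  extend it. Negation meets only atoms, which F decides on names; bounded universals reduce to
  finitely many instances.\<close>

lemma Sigma_completeness:
  "Sigma_form p \<Longrightarrow> sat e p \<Longrightarrow> theory_F \<turnstile> subst (close e) p"
proof (induction arbitrary: e rule: Sigma_form.induct)
  case (1 s t)
  then have "theory_F \<turnstile> Leq (name (val e s)) (name (val e t))"
    by (simp add: F_name_Leq)
  then have "theory_F \<turnstile> Leq (tsubst (close e) s) (tsubst (close e) t)"
    by (rule Leq_cong[OF Eq_sym[OF F_val] Eq_sym[OF F_val], OF order_refl order_refl])
  then show ?case by simp
next
  case (2 s t)
  then have "theory_F \<turnstile> Neg (Leq (name (val e s)) (name (val e t)))"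
    by (simp add: F_name_not_Leq)
  then have "theory_F \<turnstile> Neg (Leq (tsubst (close e) s) (tsubst (close e) t))"
  \<comment> \<open>Assuming the atom for the closed terms, \<open>F_val\<close> transfers it to the
    names, where F refutes it.\<close>
  proof (rule derives_contrapos)
    let ?\<Delta> = "insert (Leq (tsubst (close e) s) (tsubst (close e) t)) theory_F"
    have F: "theory_F \<subseteq> ?\<Delta>" by blast
    show "?\<Delta> \<turnstile> Leq (name (val e s)) (name (val e t))"
      by (rule Leq_cong[OF F_val[OF F] F_val[OF F]]) (simp add: Assm)
  qed
  then show ?case by simp
next
  case (3 s t)
  have "theory_F \<turnstile> Eq (tsubst (close e) s) (name (val e t))"
    using F_val[OF order_refl, of e s] 3 by simp
  from Eq_trans[OF this Eq_sym[OF F_val]] show ?case by simp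
next
  case (4 s t)
  then have "theory_F \<turnstile> Neg (Eq (name (val e s)) (name (val e t)))"
    by (simp add: F_name_neq)
  then have "theory_F \<turnstile> Neg (Eq (tsubst (close e) s) (tsubst (close e) t))"
  proof (rule derives_contrapos)
    let ?\<Delta> = "insert (Eq (tsubst (close e) s) (tsubst (close e) t)) theory_F"
    have F: "theory_F \<subseteq> ?\<Delta>" by blast
    have "?\<Delta> \<turnstile> Eq (name (val e s)) (tsubst (close e) s)" by (rule Eq_sym[OF F_val[OF F]])
    also have "?\<Delta> \<turnstile> Eq (tsubst (close e) s) (tsubst (close e) t)" by (simp add: Assm)
    also have "?\<Delta> \<turnstile> Eq (tsubst (close e) t) (name (val e t))" by (rule F_val[OF F])
    finally show "?\<Delta> \<turnstile> Eq (name (val e s)) (name (val e t))" .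
  qed
  then show ?case by simp
next
  case (5 p q)
  then show ?case by (simp add: AndI)
next
  case (6 p q)
  then show ?case by (auto intro: OrI1 OrI2)
next
  case (7 p t)
  then obtain \<alpha> where le: "length \<alpha> \<le> length (val e t)" and "sat (case_nat \<alpha> e) p"
    by auto
  then have p: "theory_F \<turnstile> subst (close (case_nat \<alpha> e)) p" by (simp add: "7.IH")
  let ?e = "case_nat \<alpha> e"
  \<comment> \<open>The lifted bound has the same value under \<open>?e\<close> as \<open>t\<close>
    under \<open>e\<close>, so the semantic bound on the witness \<alpha> becomes provable.\<close>
  have "theory_F \<turnstile> Leq (name (val ?e (Var 0))) (name (val ?e (tlift t)))"
    using le by (simp add: F_name_Leq)
  then have "theory_F \<turnstile> Leq (tsubst (close ?e) (Var 0)) (tsubst (close ?e) (tlift t))"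
    by (rule Leq_cong[OF Eq_sym[OF F_val] Eq_sym[OF F_val], rotated 2]) simp_all
  with p have "theory_F \<turnstile> subst (close ?e) (And (Leq (Var 0) (tlift t)) p)"
    by (simp only: subst.simps AndI)
  then show ?case by (rule Ex_close)
next
  case (8 p t)
  show ?case by (rule BAll_close) (use 8 in simp)
next
  case (9 p)
  then show ?case by (auto simp del: subst.simps intro: Ex_close)
qed

theorem theorem6:
  fixes \<phi> :: bt_form
  assumes "Sigma_form \<phi>" and "sentence \<phi>" and "\<FF> \<Turnstile> \<phi>"
  shows "theory_F \<turnstile> \<phi>"
proof -
  \<comment> \<open>Any assignment serves, since a sentence is unchanged when its variables are
    replaced by names.\<close>
  fix e :: "nat \<Rightarrow> bool list"
  have "theory_F \<turnstile> subst (close e) \<phi>"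
    using assms by (simp add: Sigma_completeness true_in_FF_def)
  then show ?thesis using assms(2) by (simp add: subst_sentence)
qed

end
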